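(* For $n\geq 1$, $a_n(312;231) = \displaystyle\sum_{k=0}^{\lfloor (n-1)/3\rfloor}\binom{n-1-k}{2k}$.
   Context: $\mathcal{S}_n$ is the set of permutations of $[n]=\{1,\dots,n\}$, written in one-line notation $\pi=\pi_1\pi_2\cdots\pi_n$ with $\pi_i=\pi(i)$. A permutation is cyclic if it consists of exactly one $n$-cycle. For a cyclic $\pi$, its standard cycle notation is $C(\pi)=(c_1,c_2,\dots,c_n)$ with $c_1=1$ and $c_i=\pi_{c_{i-1}}$ for $2\le i\le n$. A sequence of distinct integers $w_1\cdots w_m$ contains a pattern $\sigma\in\mathcal{S}_k$ if there are indices $i_1<\dots<i_k$ with $w_{i_1}\cdots w_{i_k}$ in the same relative order as $\sigma_1\cdots\sigma_k$; otherwise it avoids $\sigma$. For $\sigma,\tau\in\mathcal{S}_3$, $\mathcal{A}_n(\sigma;\tau)$ is the set of cyclic permutations $\pi\in\mathcal{S}_n$ whose one-line notation avoids $\sigma$ and whose cycle notation $C(\pi)$ (as the sequence $c_1c_2\cdots c_n$) avoids $\tau$; $a_n(\sigma;\tau)=|\mathcal{A}_n(\sigma;\tau)|$. *)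

theory Defs
  imports "HOL-Combinatorics.Combinatorics"
begin

text \<open>Sequences and patterns are lists of natural numbers. The function \<open>f\<close> lists the positions
  (counted from 0) of an occurrence of the pattern \<open>p\<close> in \<open>w\<close>.\<close>

definition contains_pattern :: "nat list \<Rightarrow> nat list \<Rightarrow> bool" where
  "contains_pattern w p \<longleftrightarrow>
     (\<exists>f :: nat \<Rightarrow> nat. strict_mono_on {..<length p} f \<and> f ` {..<length p} \<subseteq> {..<length w} \<and>
        (\<forall>i<length p. \<forall>j<length p. w ! f i < w ! f j \<longleftrightarrow> p ! i < p ! j))"

definition avoids :: "nat list \<Rightarrow> nat list \<Rightarrow> bool" where
  "avoids w p \<longleftrightarrow> \<not> contains_pattern w p"

definition one_line :: "nat \<Rightarrow> (nat \<Rightarrow> nat) \<Rightarrow> nat list" where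
  "one_line n \<pi> = map \<pi> [1..<Suc n]"

text \<open>The recursion \<open>c\<^sub>1 = 1\<close>, \<open>c\<^sub>i = \<pi> c\<^sub>i\<^sub>-\<^sub>1\<close> gives \<open>c\<^sub>i = (\<pi> ^^ (i - 1)) 1\<close>.\<close>

definition cycle_notation :: "nat \<Rightarrow> (nat \<Rightarrow> nat) \<Rightarrow> nat list" where
  "cycle_notation n \<pi> = map (\<lambda>i. (\<pi> ^^ i) 1) [0..<n]"

text \<open>Under \<open>\<pi> permutes {1..n}\<close>, the predicate \<open>cyclic_on \<pi> {1..n}\<close> says that \<open>{1..n}\<close> is a single
  orbit of \<open>\<pi>\<close>, i.e. that \<open>\<pi>\<close> consists of exactly one \<open>n\<close>-cycle (the identity for \<open>n = 1\<close>).\<close>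

definition cyclic_avoiders :: "nat \<Rightarrow> nat list \<Rightarrow> nat list \<Rightarrow> (nat \<Rightarrow> nat) set" where
  "cyclic_avoiders n \<sigma> \<tau> =
     {\<pi>. \<pi> permutes {1..n} \<and> cyclic_on \<pi> {1..n} \<and>
        avoids (one_line n \<pi>) \<sigma> \<and> avoids (cycle_notation n \<pi>) \<tau>}"

definition num_cyclic_avoiders :: "nat \<Rightarrow> nat list \<Rightarrow> nat list \<Rightarrow> nat" where
  "num_cyclic_avoiders n \<sigma> \<tau> = card (cyclic_avoiders n \<sigma> \<tau>)"

end

theory Submission
  imports Defs
begin

text \<open>
  Encode \<open>\<pi>\<close> by its cycle notation \<open>c\<close> and let \<open>j = \<pi> 1\<close>. Avoiding 231 in \<open>c\<close> forces the entries
  below \<open>j\<close> to come before the entries above \<open>j\<close>. If \<open>j \<ge> 3\<close>, avoiding 312 in \<open>\<pi>\<close> then forces \<open>\<pi>\<close>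
  to decrease on \<open>{1..j}\<close>, except at the last of these entries in \<open>c\<close>, which goes to \<open>j + 1\<close>. Hence
  \<open>c\<close> starts with the zigzag \<open>1, j, 2, j - 1, \<dots>\<close> exhausting \<open>{1..j}\<close>. If \<open>j = 2\<close>, only the entry \<open>1\<close>
  is split off. In both cases the remainder is an arbitrary avoider on the remaining interval, so the
  counts \<open>a\<^sub>n\<close> satisfy \<open>a\<^sub>n = a\<^sub>n\<^sub>-\<^sub>1 + (a\<^sub>1 + \<dots> + a\<^sub>n\<^sub>-\<^sub>3)\<close>, and by Pascal's rule so do the binomial
  sums.
\<close>

subsection \<open>Edges of a list and pattern avoidance\<close>

definition steps :: "'a list \<Rightarrow> ('a \<times> 'a) set" where
  "steps w = set (zip w (tl w))"

lemma steps_simps [simp]: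
  "steps [] = {}"
  "steps [x] = {}"
  "steps (x # y # w) = insert (x, y) (steps (y # w))"
  by (auto simp: steps_def)

lemma steps_append: "steps (u @ y # v) = steps (u @ [y]) \<union> steps (y # v)"
proof (induction u)
  case (Cons x u)
  then show ?case by (cases u) auto
qed simp

lemma steps_snoc: "w \<noteq> [] \<Longrightarrow> steps (w @ [z]) = insert (last w, z) (steps w)"
proof (induction w)
  case (Cons v w)
  then show ?case by (cases w) auto
qed simp

lemma in_steps_snoc: "(x, y) \<in> steps (w @ [z]) \<longleftrightarrow> (x, y) \<in> steps w \<or> w \<noteq> [] \<and> x = last w \<and> y = z"
  by (cases "w = []") (auto simp: steps_snoc)

lemma steps_memD:
  assumes "(x, y) \<in> steps w"
  shows "x \<in> set w" "y \<in> set (tl w)"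
  using assms by (auto simp: steps_def dest: in_set_zipE)

text \<open>Used in contradiction arguments: a value known to occur later in a list yields an edge
  pointing to it, which can then take part in a 312.\<close>

lemma steps_predecessor:
  assumes "y \<in> set w"
  obtains x where "x \<in> set (v # w)" "(x, y) \<in> steps (v # w)"
  using assms
proof (induction w arbitrary: v thesis)
  case (Cons u w)
  show ?case
  proof (cases "y = u")
    case True
    then show ?thesis using Cons.prems(1)[of v] by simp
  next
    case False
    then have "y \<in> set w" using Cons.prems(2) by simp
    then obtain x where "x \<in> set (u # w)" "(x, y) \<in> steps (u # w)"
      using Cons.IH[of u] by blast
    then show ?thesis using Cons.prems(1)[of x] by simp
  qed
qed simp

text \<open>A relation stands for the graph of a one-line notation, so that an initial segment or a suffix of
  the cycle notation contributes a subrelation.\<close>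

definition avoids_312 :: "('a::linorder \<times> 'a) set \<Rightarrow> bool" where
  "avoids_312 R \<longleftrightarrow>
     \<not> (\<exists>x1 y1 x2 y2 x3 y3. (x1, y1) \<in> R \<and> (x2, y2) \<in> R \<and> (x3, y3) \<in> R \<and>
          x1 < x2 \<and> x2 < x3 \<and> y2 < y3 \<and> y3 < y1)"

lemma avoids_312D:
  assumes "avoids_312 R" "(x1, y1) \<in> R" "(x2, y2) \<in> R" "(x3, y3) \<in> R"
    and "x1 < x2" "x2 < x3" "y2 < y3" "y3 < y1"
  shows False
  using assms unfolding avoids_312_def by blast

lemma avoids_312_mono: "avoids_312 R \<Longrightarrow> Q \<subseteq> R \<Longrightarrow> avoids_312 Q"
  unfolding avoids_312_def by blast

text \<open>The head \<open>x\<close> takes the role of the 2. In this form the condition on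
  \<open>w\<close> says how the list after \<open>x\<close> splits into entries below and above
  \<open>x\<close>.\<close>

fun avoids_231 :: "'a::linorder list \<Rightarrow> bool" where
  "avoids_231 [] = True"
| "avoids_231 (x # w) \<longleftrightarrow> sorted_wrt (\<lambda>b d. \<not> (d < x \<and> x < b)) w \<and> avoids_231 w"

lemma sorted_wrt_trivial: "(\<And>x y. x \<in> set w \<Longrightarrow> y \<in> set w \<Longrightarrow> P x y) \<Longrightarrow> sorted_wrt P w"
  by (induction w) auto

text \<open>The last entry of a 231 is its smallest. If it lies in \<open>v\<close>, so do the two
  larger ones; if it lies in \<open>u\<close>, so do the two earlier ones. Hence no occurrence
  straddles the cut.\<close>

lemma avoids_231_append:
  assumes "\<And>x y. x \<in> set u \<Longrightarrow> y \<in> set v \<Longrightarrow> x < y"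
  shows "avoids_231 (u @ v) \<longleftrightarrow> avoids_231 u \<and> avoids_231 v"
  using assms
proof (induction u)
  case (Cons x u)
  have "sorted_wrt (\<lambda>b d. \<not> (d < x \<and> x < b)) v"
    by (rule sorted_wrt_trivial) (use Cons.prems in fastforce)
  moreover have "\<not> (d < x \<and> x < b)" if "d \<in> set v" for b d
    using Cons.prems[of x d] that by auto
  ultimately show ?case using Cons by (auto simp: sorted_wrt_append)
qed simp

subsection \<open>Zigzags\<close>

fun zigzag :: "nat \<Rightarrow> nat \<Rightarrow> nat list" where
  "zigzag a b = (if b < a then [] else if a = b then [a] else a # b # zigzag (Suc a) (b - 1))"

declare zigzag.simps [simp del]

lemma zigzag_singleton [simp]: "zigzag a a = [a]"
  by (simp add: zigzag.simps)

lemma zigzag_Cons2: "a < b \<Longrightarrow> zigzag a b = a # b # zigzag (Suc a) (b - 1)"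
  by (subst zigzag.simps) simp

lemma zigzag_empty: "b < a \<Longrightarrow> zigzag a b = []"
  by (simp add: zigzag.simps)

lemma set_zigzag [simp]: "set (zigzag a b) = {a..b}"
proof (induction a b rule: zigzag.induct)
  case (1 a b)
  consider "b < a" | "a = b" | "a < b" by linarith
  then show ?case
  proof cases
    case 3
    then have "set (zigzag a b) = {a, b} \<union> {Suc a..b - 1}"
      using 1 by (simp add: zigzag_Cons2[of a b])
    also have "\<dots> = {a..b}" using 3 by auto
    finally show ?thesis .
  qed (simp_all add: zigzag_empty)
qed

lemma distinct_zigzag: "distinct (zigzag a b)"
proof (induction a b rule: zigzag.induct)
  case (1 a b)
  consider "b < a" | "a = b" | "a < b" by linarith
  then show ?case
  proof cases
    case 3
    then have "distinct (zigzag (Suc a) (b - 1))" using 1 by simp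
    with 3 show ?thesis by (simp add: zigzag_Cons2[of a b])
  qed (simp_all add: zigzag_empty)
qed

text \<open>The first two entries are the minimum and the maximum of the interval, so neither can be
  the 2 of a 231.\<close>

lemma avoids_231_zigzag: "avoids_231 (zigzag a b)"
proof (induction a b rule: zigzag.induct)
  case (1 a b)
  consider "b < a" | "a = b" | "a < b" by linarith
  then show ?case
  proof cases
    case 3
    then have "avoids_231 (zigzag (Suc a) (b - 1))" using 1 by simp
    moreover have "sorted_wrt (\<lambda>y z. \<not> (z < x \<and> x < y)) (zigzag (Suc a) (b - 1))"
      if "x = a \<or> x = b" for x
      by (rule sorted_wrt_trivial) (use that 3 in auto)
    ultimately show ?thesis using 3 by (simp add: zigzag_Cons2)
  qed (auto simp: zigzag_empty)
qed

text \<open>Sums of consecutive entries alternate between \<open>a + b\<close> and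
  \<open>a + b + 1\<close>, and passing to the inner interval leaves \<open>a + b\<close>
  unchanged.\<close>

lemma steps_zigzag_sum:
  "(x, y) \<in> steps (zigzag a b) \<Longrightarrow> a + b \<le> x + y \<and> x + y \<le> Suc (a + b)"
proof (induction a b rule: zigzag.induct)
  case (1 a b)
  consider "b < a" | "a = b" | "b = Suc a" | "Suc a < b" by linarith
  then show ?case
  proof cases
    case 4
    obtain u where u: "zigzag (Suc a) (b - 1) = Suc a # u"
      using 4 by (cases "Suc a = b - 1") (simp_all add: zigzag_Cons2)
    have "zigzag a b = a # b # zigzag (Suc a) (b - 1)"
      using 4 by (simp add: zigzag_Cons2)
    then consider "x = a" "y = b" | "x = b" "y = Suc a" | "(x, y) \<in> steps (zigzag (Suc a) (b - 1))"
      using "1.prems" u by auto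
    then show ?thesis
    proof cases
      case 3
      then have "Suc a + (b - 1) \<le> x + y \<and> x + y \<le> Suc (Suc a + (b - 1))"
        using "1.IH" 4 by simp
      then show ?thesis using 4 by simp
    qed simp_all
  qed (use "1.prems" in \<open>simp_all add: zigzag_empty zigzag_Cons2\<close>)
qed

lemma steps_zigzag_antimono:
  assumes "(x, y) \<in> steps (zigzag a b)" "(x', y') \<in> steps (zigzag a b)" "x < x'"
  shows "y' \<le> y"
  using steps_zigzag_sum[OF assms(1)] steps_zigzag_sum[OF assms(2)] assms(3) by linarith

text \<open>The edge from \<open>a\<close> to \<open>b\<close> can serve as the 3 of a 312, so the
  targets of all other edges decrease as their sources grow. Thus \<open>b\<close> is followed by
  the least remaining value \<open>Suc a\<close>, and \<open>Suc a\<close> by the greatest,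
  \<open>b - 1\<close>. This restores the hypothesis on the first two entries for the inner
  interval.\<close>

lemma zigzag_unique:
  assumes "a \<le> b" "distinct w" "set w = {a..b}" "avoids_312 (steps w)"
    and "a < b \<Longrightarrow> \<exists>u. w = a # b # u"
  shows "w = zigzag a b"
  using assms
proof (induction a b arbitrary: w rule: zigzag.induct)
  case (1 a b)
  show ?case
  proof (cases "a = b")
    case True
    then have "length w = 1" using distinct_card[OF "1.prems"(2)] "1.prems"(3) by simp
    then obtain z where "w = [z]" by (cases w) auto
    then show ?thesis using True "1.prems"(3) by simp
  next
    case False
    then have ab: "a < b" using "1.prems"(1) by simp
    obtain u where w: "w = a # b # u" using "1.prems"(5) ab by blast
    have "set u = set w - {a, b}" using w "1.prems"(2) by auto
    moreover have "{a..b} - {a, b} = {Suc a..b - 1}" using ab by auto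
    ultimately have su: "set u = {Suc a..b - 1}" by (simp only: "1.prems"(3))
    have av: "avoids_312 (steps w)" by fact
    have mem: "z \<in> set u \<longleftrightarrow> a < z \<and> z < b" for z
      using su ab by auto
    show ?thesis
    proof (cases u)
      case Nil
      then have "b - 1 < Suc a" using su by auto
      then show ?thesis using w Nil ab by (simp add: zigzag_Cons2 zigzag_empty)
    next
      case (Cons h t)
      have h: "a < h" "h < b" using mem[of h] Cons by simp_all
      have "h = Suc a"
      proof (rule ccontr)
        \<comment> \<open>Otherwise \<open>Suc a\<close> has a later predecessor \<open>x\<close>,
          and the edges from \<open>a\<close>, \<open>x\<close>, \<open>b\<close> to
          \<open>b\<close>, \<open>Suc a\<close>, \<open>h\<close> form a 312.\<close>
        assume ne: "h \<noteq> Suc a"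
        then have "Suc a \<in> set t" using mem[of "Suc a"] Cons h by simp
        then obtain x where x: "x \<in> set (h # t)" "(x, Suc a) \<in> steps (h # t)"
          by (rule steps_predecessor)
        have "a < x" "x < b" using x(1) mem[of x] Cons by simp_all
        moreover have "Suc a < h" using ne h by simp
        ultimately show False
          using avoids_312D[OF av, of a b x "Suc a" b h] x(2) h(2) by (simp add: w Cons)
      qed
      have ex: "\<exists>v. u = Suc a # (b - 1) # v" if lt: "Suc a < b - 1"
      proof (cases t)
        case Nil
        then have "b - 1 = Suc a" using mem[of "b - 1"] lt Cons \<open>h = Suc a\<close> by simp
        then show ?thesis using lt by simp
      next
        case t: (Cons k v)
        have "k = b - 1"
        proof (rule ccontr)
          \<comment> \<open>Here the 312 consists of the edges from \<open>a\<close>,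
            \<open>Suc a\<close>, \<open>x\<close> to \<open>b\<close>, \<open>k\<close>,
            \<open>b - 1\<close>.\<close>
          assume "k \<noteq> b - 1"
          moreover have "k < b" using mem[of k] Cons t by simp
          ultimately have k: "k < b - 1" by simp
          then have "b - 1 \<in> set v"
            using mem[of "b - 1"] Cons t \<open>h = Suc a\<close> lt by simp
          then obtain x where x: "x \<in> set (k # v)" "(x, b - 1) \<in> steps (k # v)"
            by (rule steps_predecessor)
          have "x \<in> set u" "x \<noteq> h"
            using x(1) Cons t "1.prems"(2) w by auto
          then have "Suc a < x" using mem[of x] \<open>h = Suc a\<close> by simp
          then show False
            using avoids_312D[OF av, of a b "Suc a" k x "b - 1"] x(2) k lt
            by (simp add: w Cons t \<open>h = Suc a\<close>)
        qed
        then show ?thesis using Cons t \<open>h = Suc a\<close> by simp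
      qed
      have "u = zigzag (Suc a) (b - 1)"
      proof (rule "1.IH")
        show "avoids_312 (steps u)"
          by (rule avoids_312_mono[OF av]) (auto simp: w Cons)
        show "distinct u" using "1.prems"(2) w by simp
        show "Suc a \<le> b - 1" using h by simp
      qed (use ab in simp, use ab in simp, fact su, fact ex)
      then show ?thesis using w ab by (simp add: zigzag_Cons2)
    qed
  qed
qed

subsection \<open>Decomposition of cycle notations\<close>

text \<open>The edge closing the cycle points to \<open>0\<close> instead of \<open>a\<close>. This does not affect the relative order of
  the values, and makes the condition on the edges independent of the first entry, hence inherited by
  suffixes.\<close>

definition cycle_words :: "nat \<Rightarrow> nat \<Rightarrow> nat list set" where
  "cycle_words a b =
     {c. distinct c \<and> set c = {a..b} \<and> hd c = a \<and> avoids_231 c \<and> avoids_312 (steps (c @ [0]))}"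

lemma cycle_words_Cons:
  assumes "c \<in> cycle_words a b" "a \<le> b"
  obtains c' where "c = a # c'"
  using assms by (cases c) (auto simp: cycle_words_def)

lemma cycle_words_self: "cycle_words a a = {[a]}"
proof -
  have "c = [a]" if "distinct c" "set c = {a}" for c
  proof -
    have "length c = 1" using distinct_card[OF that(1)] that(2) by simp
    then obtain z where "c = [z]" by (cases c) auto
    then show ?thesis using that by simp
  qed
  then show ?thesis by (auto simp: cycle_words_def avoids_312_def)
qed

lemma finite_cycle_words: "finite (cycle_words a b)"
proof (rule finite_subset)
  show "cycle_words a b \<subseteq> {c. set c \<subseteq> {a..b} \<and> length c = card {a..b}}"
    by (auto simp: cycle_words_def simp flip: distinct_card)
qed (simp add: finite_lists_length_eq)

lemma in_set_tlD: "x \<in> set (tl w) \<Longrightarrow> x \<in> set w"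
  by (cases w) auto

text \<open>Edges leaving \<open>{a..j}\<close> have targets at most \<open>Suc j\<close>, whereas
  edges leaving \<open>{Suc j..b}\<close> have targets above \<open>Suc j\<close> or equal to
  \<open>0\<close>. This keeps a 312 from mixing the two blocks.\<close>

lemma zigzag_append_cycle_words:
  assumes "a \<le> j" "j < b" "v \<in> cycle_words (Suc j) b"
  shows "zigzag a j @ v \<in> cycle_words a b"
proof -
  obtain v' where v': "v = Suc j # v'"
    using cycle_words_Cons[OF assms(3)] assms(2) by auto
  have v: "distinct v" "set v = {Suc j..b}" "avoids_231 v" "avoids_312 (steps (v @ [0]))"
    using assms(3) by (auto simp: cycle_words_def)
  have "hd (zigzag a j @ v) = a"
    using assms(1) by (subst zigzag.simps) simp
  moreover have "set (zigzag a j @ v) = {a..b}"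
  proof -
    have "set (zigzag a j @ v) = {a..j} \<union> {Suc j..b}" by (simp add: v(2))
    also have "\<dots> = {a..b}" using assms(1,2) by auto
    finally show ?thesis .
  qed
  moreover have "distinct (zigzag a j @ v)" using v(1,2) by (auto simp: distinct_zigzag)
  moreover have "avoids_231 (zigzag a j @ v)"
    using v(2,3) by (subst avoids_231_append) (auto simp: avoids_231_zigzag)
  moreover have "avoids_312 (steps ((zigzag a j @ v) @ [0]))"
    unfolding avoids_312_def
  proof clarify
    fix x1 y1 x2 y2 x3 y3
    let ?R = "steps ((zigzag a j @ v) @ [0])"
    assume *: "(x1, y1) \<in> ?R" "(x2, y2) \<in> ?R" "(x3, y3) \<in> ?R"
      and "x1 < x2" "x2 < x3" "y2 < y3" "y3 < y1"
    \<comment> \<open>The edge linking the blocks is counted with the zigzag; its target is the head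
      of \<open>v\<close>.\<close>
    have R: "?R = steps (zigzag a j @ [Suc j]) \<union> steps (v @ [0])"
      using steps_append[of "zigzag a j" "Suc j" "v' @ [0]"] by (simp add: v')
    have tail: "Suc j \<le> x \<and> (y = 0 \<or> Suc j < y)" if "(x, y) \<in> steps (v @ [0])" for x y
    proof
      have "x \<in> set v"
        using that by (auto simp: in_steps_snoc dest: steps_memD(1) last_in_set)
      then show "Suc j \<le> x" using v(2) by simp
      have "y = 0 \<or> y \<in> set v'"
        using that steps_memD(2)[of x y v] v' unfolding in_steps_snoc by auto
      moreover have "Suc j < y" if "y \<in> set v'"
      proof -
        have "y \<in> set v" "y \<noteq> Suc j" using that v(1) v' by auto
        then show ?thesis using v(2) by simp
      qed
      ultimately show "y = 0 \<or> Suc j < y" by blast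
    qed
    have head: "x \<le> j \<and> y \<le> Suc j \<and> (y \<le> j \<longrightarrow> (x, y) \<in> steps (zigzag a j))"
      if "(x, y) \<in> steps (zigzag a j @ [Suc j])" for x y
    proof -
      consider "(x, y) \<in> steps (zigzag a j)" | "x = last (zigzag a j)" "zigzag a j \<noteq> []" "y = Suc j"
        using \<open>(x, y) \<in> _\<close> by (auto simp: in_steps_snoc)
      then show ?thesis
      proof cases
        case 1
        have "x \<in> set (zigzag a j)" "y \<in> set (zigzag a j)"
          using steps_memD[OF 1] by (auto dest: in_set_tlD)
        then show ?thesis using 1 by simp
      next
        case 2
        then have "x \<in> set (zigzag a j)" using last_in_set by blast
        then show ?thesis using 2 by simp
      qed
    qed
    show False
    proof (cases "j < x1")
      case True
      then have "j < x2" "j < x3" using \<open>x1 < x2\<close> \<open>x2 < x3\<close> by simp_all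
      then have "(x1, y1) \<in> steps (v @ [0])" "(x2, y2) \<in> steps (v @ [0])" "(x3, y3) \<in> steps (v @ [0])"
        using * True head[of x1 y1] head[of x2 y2] head[of x3 y3] unfolding R by auto
      then show False
        using avoids_312D[OF v(4)] \<open>x1 < x2\<close> \<open>x2 < x3\<close> \<open>y2 < y3\<close> \<open>y3 < y1\<close> by blast
    next
      case False
      \<comment> \<open>Since \<open>y2 < y3 < y1\<close>, the value \<open>y3\<close> is neither
        \<open>0\<close> nor above \<open>j\<close>. So the last two edges lie inside the zigzag,
        whose targets do not increase.\<close>
      then have "y1 \<le> Suc j" using * tail[of x1 y1] head[of x1 y1] unfolding R by auto
      then have 3: "(x3, y3) \<in> steps (zigzag a j)" "x3 \<le> j"
        using * tail[of x3 y3] head[of x3 y3] \<open>y3 < y1\<close> \<open>y2 < y3\<close> unfolding R by auto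
      then have "(x2, y2) \<in> steps (zigzag a j)"
        using * tail[of x2 y2] head[of x2 y2] \<open>x2 < x3\<close> \<open>y2 < y3\<close> \<open>y3 < y1\<close> \<open>y1 \<le> Suc j\<close> unfolding R
        by auto
      then have "y3 \<le> y2" using 3(1) \<open>x2 < x3\<close> by (rule steps_zigzag_antimono)
      then show False using \<open>y2 < y3\<close> by simp
    qed
  qed
  ultimately show ?thesis by (simp add: cycle_words_def)
qed

text \<open>An entry below \<open>x\<close> after one above \<open>x\<close> would complete a 231
  with \<open>x\<close> as its 2.\<close>

lemma sorted_wrt_separated:
  assumes "sorted_wrt (\<lambda>b d. \<not> (d < x \<and> x < b)) w" "(x::'a::linorder) \<notin> set w"
  obtains u v where "w = u @ v" "\<And>y. y \<in> set u \<Longrightarrow> y < x" "\<And>y. y \<in> set v \<Longrightarrow> x < y"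
proof -
  have "\<exists>u v. w = u @ v \<and> (\<forall>y\<in>set u. y < x) \<and> (\<forall>y\<in>set v. x < y)"
    using assms
  proof (induction w)
    case (Cons z w)
    then obtain u v where *: "w = u @ v" "\<forall>y\<in>set u. y < x" "\<forall>y\<in>set v. x < y" by auto
    show ?case
    proof (cases "z < x")
      case True
      then show ?thesis using * by (intro exI[of _ "z # u"] exI[of _ v]) simp
    next
      case False
      then have "x < z" using Cons.prems(2) by auto
      then have "u = []" using Cons.prems(1) * by (cases u) auto
      then show ?thesis using * \<open>x < z\<close> by (intro exI[of _ "[]"] exI[of _ "z # v"]) simp
    qed
  qed simp
  then show ?thesis using that by blast
qed

text \<open>The choice \<open>j = a\<close> covers the words with second entry \<open>Suc a\<close>,
  where only \<open>[a]\<close> is split off; otherwise \<open>j\<close> is the second entry.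
  Excluding \<open>j = Suc a\<close> prevents counting the former words twice, since
  \<open>[a, Suc a]\<close> followed by a word is also \<open>[a]\<close> followed by a longer
  one.\<close>

lemma cycle_words_decompose:
  assumes "c \<in> cycle_words a b" "a < b"
  obtains j v where "a \<le> j" "j < b" "j \<noteq> Suc a" "v \<in> cycle_words (Suc j) b" "c = zigzag a j @ v"
proof -
  obtain c' where c': "c = a # c'" using cycle_words_Cons[OF assms(1)] assms(2) by auto
  have c: "distinct c" "set c = {a..b}" "avoids_231 c" and av: "avoids_312 (steps (c @ [0]))"
    using assms(1) by (auto simp: cycle_words_def)
  have sc': "set c' = {Suc a..b}"
  proof -
    have "set c' = set c - {a}" using c(1) by (simp add: c')
    also have "\<dots> = {Suc a..b}" unfolding c(2) by auto
    finally show ?thesis .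
  qed
  then obtain j w where w: "c' = j # w" using assms(2) by (cases c') auto
  have j: "a < j" "j \<le> b"
    using sc' w by (metis Suc_le_eq atLeastAtMost_iff list.set_intros(1))+
  show thesis
  proof (cases "j = Suc a")
    case True
    have "avoids_312 (steps (c' @ [0]))"
      by (rule avoids_312_mono[OF av]) (auto simp: c' w)
    then have "c' \<in> cycle_words (Suc a) b"
      using c sc' w True by (simp add: cycle_words_def c')
    then show thesis using that[of a c'] assms(2) c' by simp
  next
    case False
    then have aj: "Suc a < j" using j by simp
    have "sorted_wrt (\<lambda>b d. \<not> (d < j \<and> j < b)) w" "j \<notin> set w"
      using c(1,3) by (simp_all add: c' w)
    then obtain u v where uv: "w = u @ v" "\<And>y. y \<in> set u \<Longrightarrow> y < j" "\<And>y. y \<in> set v \<Longrightarrow> j < y"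
      by (rule sorted_wrt_separated) blast
    have mem: "y \<in> set u \<or> y \<in> set v \<longleftrightarrow> a < y \<and> y \<le> b \<and> y \<noteq> j" for y
    proof -
      have "y \<in> set c' \<longleftrightarrow> a < y \<and> y \<le> b" unfolding sc' by auto
      then show ?thesis using c(1) by (auto simp: c' w uv(1))
    qed
    have memu: "y \<in> set u \<longleftrightarrow> a < y \<and> y < j" for y
      using mem[of y] uv(2,3)[of y] j by auto
    have memv: "y \<in> set v \<longleftrightarrow> j < y \<and> y \<le> b" for y
      using mem[of y] uv(2,3)[of y] j by auto
    obtain h t where u: "u = h # t" using memu[of "Suc a"] aj by (cases u) auto
    have h: "a < h" "h < j" using memu[of h] u by simp_all
    have last_u: "last u \<in> set u" using u last_in_set[of u] by simp
    then have lu: "a < last u" "last u < j" using memu by simp_all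
    \<comment> \<open>Writing the target of the linking edge as \<open>hd (v @ [0])\<close> also
      covers an empty \<open>v\<close>, where this edge is the closing one.\<close>
    have R: "steps (c @ [0]) = steps (a # j # u) \<union> {(last u, hd (v @ [0]))} \<union> steps (v @ [0])"
    proof -
      obtain m v' where m: "v @ [0] = m # v'" by (cases "v @ [0]") auto
      have "steps (c @ [0]) = steps ((a # j # u) @ m # v')"
        using m by (simp add: c' w uv(1))
      also have "\<dots> = steps ((a # j # u) @ [m]) \<union> steps (m # v')" by (rule steps_append)
      also have "steps ((a # j # u) @ [m]) = steps (a # j # u) \<union> {(last u, m)}"
        using steps_snoc[of "a # j # u" m] u by simp
      finally show ?thesis by (simp only: m list.sel)
    qed
    have in_head: "(a, j) \<in> steps (c @ [0])" "(j, h) \<in> steps (c @ [0])"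
      by (simp_all add: R u)
    have link: "(last u, hd (v @ [0])) \<in> steps (c @ [0])" by (simp add: R)
    have "v \<noteq> []"
    proof
      assume "v = []"
      \<comment> \<open>If \<open>v\<close> is empty, the edges from \<open>a\<close>,
        \<open>last u\<close>, \<open>j\<close> to \<open>j\<close>, \<open>0\<close>,
        \<open>h\<close> form a 312. This rules out \<open>j = b\<close>.\<close>
      then show False
        using avoids_312D[OF av in_head(1) link in_head(2)] lu h by simp
    qed
    then obtain m v' where v: "v = m # v'" by (cases v) auto
    have m: "j < m" "m \<le> b" using memv[of m] v by simp_all
    have "m = Suc j"
    proof (rule ccontr)
      \<comment> \<open>The edges from \<open>last u\<close>, \<open>j\<close>, \<open>x\<close> to
        \<open>m\<close>, \<open>h\<close>, \<open>Suc j\<close> would form a 312.\<close>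
      assume "m \<noteq> Suc j"
      then have "Suc j \<in> set v'" using memv[of "Suc j"] v m by simp
      then obtain x where x: "x \<in> set (m # v')" "(x, Suc j) \<in> steps (m # v')"
        by (rule steps_predecessor)
      have "(x, Suc j) \<in> steps (c @ [0])"
        using x(2) in_steps_snoc[of x "Suc j" v 0] by (simp add: R v)
      moreover have "j < x" using x(1) memv[of x] v by simp
      ultimately show False
        using avoids_312D[OF av link in_head(2), of x "Suc j"] lu h m \<open>m \<noteq> Suc j\<close> v by simp
    qed
    have "v \<in> cycle_words (Suc j) b"
    proof -
      have "avoids_231 v"
      proof -
        have "avoids_231 (u @ v)" using c(3) by (simp add: c' w uv(1))
        moreover have "x < y" if "x \<in> set u" "y \<in> set v" for x y
          using uv(2)[OF that(1)] uv(3)[OF that(2)] by simp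
        ultimately show ?thesis by (simp add: avoids_231_append)
      qed
      moreover have "avoids_312 (steps (v @ [0]))"
        by (rule avoids_312_mono[OF av]) (auto simp: R)
      moreover have "set v = {Suc j..b}"
        by (intro set_eqI) (simp only: memv atLeastAtMost_iff Suc_le_eq)
      ultimately show ?thesis
        using c(1) \<open>m = Suc j\<close> by (simp add: cycle_words_def c' w uv(1) v)
    qed
    moreover have "a # j # u = zigzag a j"
    proof (rule zigzag_unique)
      show "avoids_312 (steps (a # j # u))"
        by (rule avoids_312_mono[OF av]) (auto simp: R)
      have "y \<in> set (a # j # u) \<longleftrightarrow> a \<le> y \<and> y \<le> j" for y
        using memu[of y] j by auto
      then show "set (a # j # u) = {a..j}" by (intro set_eqI) (simp only: atLeastAtMost_iff)
      show "distinct (a # j # u)" using c(1) by (simp add: c' w uv(1))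
    qed (use j in simp_all)
    ultimately show thesis
      using that[of j v] aj m uv(1) by (simp add: c' w flip: append_Cons)
  qed
qed

section \<open>Counting by the initial zigzag\<close>

lemma cycle_words_rec:
  assumes "a < b"
  shows "cycle_words a b =
    (\<Union>j\<in>{a..<b} - {Suc a}. (@) (zigzag a j) ` cycle_words (Suc j) b)"
proof (intro equalityI subsetI)
  fix c assume "c \<in> cycle_words a b"
  then obtain j v where "j \<in> {a..<b} - {Suc a}" "v \<in> cycle_words (Suc j) b" "c = zigzag a j @ v"
    using assms by (rule cycle_words_decompose) auto
  then show "c \<in> (\<Union>j\<in>{a..<b} - {Suc a}. (@) (zigzag a j) ` cycle_words (Suc j) b)"
    by blast
next
  fix c assume "c \<in> (\<Union>j\<in>{a..<b} - {Suc a}. (@) (zigzag a j) ` cycle_words (Suc j) b)"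
  then obtain j v where "j \<in> {a..<b}" "v \<in> cycle_words (Suc j) b" "c = zigzag a j @ v"
    by blast
  then show "c \<in> cycle_words a b" using zigzag_append_cycle_words[of a j b v] by simp
qed

text \<open>For \<open>j\<close> different from \<open>Suc a\<close>, the second entry determines
  \<open>j\<close>; this makes the union in \<open>cycle_words_rec\<close> disjoint.\<close>

lemma zigzag_append_nth_1:
  assumes "a \<le> j" "j < b" "v \<in> cycle_words (Suc j) b"
  shows "(zigzag a j @ v) ! 1 = (if j = a then Suc a else j)"
proof -
  obtain v' where "v = Suc j # v'"
    using cycle_words_Cons[OF assms(3)] assms(2) by auto
  then show ?thesis using assms(1) by (cases "a = j") (simp_all add: zigzag_Cons2[of a j])
qed

lemma card_cycle_words_rec:
  assumes "a < b"
  shows "card (cycle_words a b) = (\<Sum>j\<in>{a..<b} - {Suc a}. card (cycle_words (Suc j) b))"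
proof -
  have "card (cycle_words a b) =
      (\<Sum>j\<in>{a..<b} - {Suc a}. card ((@) (zigzag a j) ` cycle_words (Suc j) b))"
    unfolding cycle_words_rec[OF assms]
  proof (rule card_UN_disjoint)
    show "\<forall>i\<in>{a..<b} - {Suc a}. \<forall>j\<in>{a..<b} - {Suc a}. i \<noteq> j \<longrightarrow>
        (@) (zigzag a i) ` cycle_words (Suc i) b \<inter> (@) (zigzag a j) ` cycle_words (Suc j) b = {}"
    proof (intro ballI impI, rule ccontr)
      fix i j assume ij: "i \<in> {a..<b} - {Suc a}" "j \<in> {a..<b} - {Suc a}" "i \<noteq> j"
      assume "(@) (zigzag a i) ` cycle_words (Suc i) b \<inter> (@) (zigzag a j) ` cycle_words (Suc j) b \<noteq> {}"
      then obtain u v where uv: "u \<in> cycle_words (Suc i) b" "v \<in> cycle_words (Suc j) b"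
        "zigzag a i @ u = zigzag a j @ v" by blast
      then have "(if i = a then Suc a else i) = (if j = a then Suc a else j)"
        using zigzag_append_nth_1[of a i b u] zigzag_append_nth_1[of a j b v] ij by simp
      then show False using ij by (auto split: if_splits)
    qed
  qed (simp_all add: finite_cycle_words)
  also have "\<dots> = (\<Sum>j\<in>{a..<b} - {Suc a}. card (cycle_words (Suc j) b))"
    by (intro sum.cong refl card_image inj_onI) simp
  finally show ?thesis .
qed

subsection \<open>The recurrence for the binomial sums\<close>

text \<open>The range is longer than in the theorem, but the terms beyond \<open>m div 3\<close>
  vanish; this spares divisions in the recurrence.\<close>

definition diag_binomial_sum :: "nat \<Rightarrow> nat" where
  "diag_binomial_sum m = (\<Sum>k\<le>m. (m - k) choose (2 * k))"

lemma diag_binomial_sum_extend: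
  assumes "m \<le> N"
  shows "diag_binomial_sum m = (\<Sum>k\<le>N. (m - k) choose (2 * k))"
  \<comment> \<open>For \<open>k > m\<close> truncated subtraction gives
    \<open>0 choose (2 * k)\<close> with \<open>k > 0\<close>, which is \<open>0\<close>.\<close>
  unfolding diag_binomial_sum_def by (rule sum.mono_neutral_left) (use assms in auto)

lemma diag_binomial_sum_eq: "diag_binomial_sum m = (\<Sum>k = 0..m div 3. (m - k) choose (2 * k))"
  unfolding diag_binomial_sum_def
  by (rule sum.mono_neutral_right) (auto intro!: binomial_eq_0)

text \<open>By Pascal's rule, raising \<open>m\<close> by one adds
  \<open>(m - k) choose (2 * k)\<close> to each term on the right. The fixed bound \<open>N\<close>
  keeps all sums over the same range.\<close>

lemma sum_diag_binomial_sum: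
  assumes "m \<le> N"
  shows "(\<Sum>i<m. diag_binomial_sum i) = (\<Sum>k\<le>N. (m - k) choose (2 * k + 1))"
  using assms
proof (induction m)
  case (Suc m)
  have "(Suc m - k) choose (2 * k + 1) = ((m - k) choose (2 * k + 1)) + ((m - k) choose (2 * k))" for k
    by (cases "k \<le> m") (simp_all add: Suc_diff_le)
  then show ?case using Suc by (simp add: diag_binomial_sum_extend[of m N] sum.distrib)
qed simp

text \<open>Split off the term \<open>k = 0\<close>, shift the index and apply Pascal's rule. The
  even lower indices, with the split-off \<open>1\<close>, reassemble to the sum for
  \<open>m\<close>; the odd ones are given by \<open>sum_diag_binomial_sum\<close>.\<close>

lemma diag_binomial_sum_Suc: "diag_binomial_sum (Suc m) = diag_binomial_sum m + (\<Sum>i<m - 1. diag_binomial_sum i)"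
proof (cases m)
  case 0
  then show ?thesis by (simp add: diag_binomial_sum_def)
next
  case (Suc p)
  have *: "(Suc p - k) choose (2 * Suc k) =
      ((p - k) choose (2 * Suc k)) + ((p - k) choose (2 * k + 1))" for k
    by (cases "k \<le> p") (simp_all add: Suc_diff_le)
  have "diag_binomial_sum (Suc m) = 1 + (\<Sum>k\<le>m. (Suc p - k) choose (2 * Suc k))"
    by (simp add: diag_binomial_sum_def sum.atMost_Suc_shift Suc del: sum.atMost_Suc)
  also have "\<dots> = 1 + (\<Sum>k\<le>m. (p - k) choose (2 * Suc k)) + (\<Sum>k\<le>m. (p - k) choose (2 * k + 1))"
    by (simp only: * sum.distrib add.assoc)
  also have "1 + (\<Sum>k\<le>m. (p - k) choose (2 * Suc k)) = (\<Sum>k\<le>Suc m. (m - k) choose (2 * k))"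
    unfolding sum.atMost_Suc_shift by (simp add: Suc del: sum.atMost_Suc)
  also have "\<dots> = diag_binomial_sum m"
    by (rule diag_binomial_sum_extend[symmetric]) simp
  also have "(\<Sum>k\<le>m. (p - k) choose (2 * k + 1)) = (\<Sum>i<p. diag_binomial_sum i)"
    by (rule sum_diag_binomial_sum[symmetric]) (simp add: Suc)
  finally show ?thesis by (simp add: Suc)
qed

lemma card_cycle_words:
  "a \<le> b \<Longrightarrow> card (cycle_words a b) = diag_binomial_sum (b - a)"
proof (induction "b - a" arbitrary: a rule: less_induct)
  case less
  show ?case
  proof (cases "a = b")
    case True
    then show ?thesis by (simp add: cycle_words_self diag_binomial_sum_def)
  next
    case False
    then have ab: "a < b" using less.prems by simp
    then have split: "{a..<b} - {Suc a} = insert a {Suc (Suc a)..<b}" by auto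
    have "card (cycle_words a b) = (\<Sum>j\<in>{a..<b} - {Suc a}. diag_binomial_sum (b - Suc j))"
      unfolding card_cycle_words_rec[OF ab]
    proof (rule sum.cong)
      fix j assume "j \<in> {a..<b} - {Suc a}"
      then show "card (cycle_words (Suc j) b) = diag_binomial_sum (b - Suc j)"
        by (intro less.hyps) auto
    qed simp
    also have "\<dots> = diag_binomial_sum (b - Suc a) + (\<Sum>j = Suc (Suc a)..<b. diag_binomial_sum (b - Suc j))"
      unfolding split by (subst sum.insert) auto
    \<comment> \<open>Substituting \<open>i = b - Suc j\<close> sends \<open>j = a + 2\<close> to
      \<open>i = b - a - 3\<close> and \<open>j = b - 1\<close> to \<open>i = 0\<close>.\<close>
    also have "(\<Sum>j = Suc (Suc a)..<b. diag_binomial_sum (b - Suc j)) = (\<Sum>i<b - Suc a - 1. diag_binomial_sum i)"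
      by (rule sum.reindex_bij_witness[of _ "\<lambda>i. b - Suc i" "\<lambda>j. b - Suc j"]) auto
    also have "diag_binomial_sum (b - Suc a) + (\<Sum>i<b - Suc a - 1. diag_binomial_sum i) = diag_binomial_sum (Suc (b - Suc a))"
      by (rule diag_binomial_sum_Suc[symmetric])
    also have "Suc (b - Suc a) = b - a" using ab by simp
    finally show ?thesis .
  qed
qed

subsection \<open>From permutations to cycle notations\<close>

lemma contains_pattern_triple:
  "contains_pattern w [p, q, r] \<longleftrightarrow>
     (\<exists>i j k. i < j \<and> j < k \<and> k < length w \<and>
        (w ! i < w ! j \<longleftrightarrow> p < q) \<and> (w ! j < w ! i \<longleftrightarrow> q < p) \<and>
        (w ! i < w ! k \<longleftrightarrow> p < r) \<and> (w ! k < w ! i \<longleftrightarrow> r < p) \<and>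
        (w ! j < w ! k \<longleftrightarrow> q < r) \<and> (w ! k < w ! j \<longleftrightarrow> r < q))"
    (is "?L \<longleftrightarrow> (\<exists>i j k. ?P i j k)")
proof
  have set3: "{..<length [p, q, r]} = {0, 1, 2}" by auto
  have all3: "(\<forall>i<length [p, q, r]. Q i) \<longleftrightarrow> Q 0 \<and> Q 1 \<and> Q 2" for Q
    by (simp add: All_less_Suc numeral_2_eq_2) auto
  {
    assume ?L
    then obtain f where f: "strict_mono_on {0, 1, 2} f" "f ` {0, 1, 2} \<subseteq> {..<length w}"
      and lt: "\<forall>i<length [p, q, r]. \<forall>j<length [p, q, r]. w ! f i < w ! f j \<longleftrightarrow> [p, q, r] ! i < [p, q, r] ! j"
      unfolding contains_pattern_def set3 by blast
    have "f 0 < f 1" "f 1 < f 2" by (rule strict_mono_onD[OF f(1)]; simp)+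
    then have "?P (f 0) (f 1) (f 2)"
      using f(2) lt unfolding all3 by simp
    then show "\<exists>i j k. ?P i j k" by blast
  }
  {
    assume "\<exists>i j k. ?P i j k"
    then obtain i j k where P: "?P i j k" by blast
    define f where "f = (\<lambda>t::nat. if t = 0 then i else if t = 1 then j else k)"
    have f: "f 0 = i" "f 1 = j" "f 2 = k" by (simp_all add: f_def)
    have nth: "[p, q, r] ! 0 = p" "[p, q, r] ! 1 = q" "[p, q, r] ! 2 = r" by simp_all
    have "i < j" "j < k" "k < length w" using P by blast+
    then have "strict_mono_on {0, 1, 2} f" "f ` {0, 1, 2} \<subseteq> {..<length w}"
      by (auto simp: f_def strict_mono_on_def)
    moreover have "\<forall>a<length [p, q, r]. \<forall>b<length [p, q, r]. w ! f a < w ! f b \<longleftrightarrow> [p, q, r] ! a < [p, q, r] ! b"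
      unfolding all3 f nth less_irrefl using P by blast
    ultimately show ?L unfolding contains_pattern_def set3 by blast
  }
qed

text \<open>An occurrence in \<open>x # w\<close> either uses position \<open>0\<close>, necessarily
  as the 2, or is an occurrence in \<open>w\<close> shifted by one.\<close>

lemma avoids_231_iff_nth:
  "avoids_231 w \<longleftrightarrow> \<not> (\<exists>i j k. i < j \<and> j < k \<and> k < length w \<and> w ! k < w ! i \<and> w ! i < w ! j)"
proof (induction w)
  case (Cons x w)
  have "(\<exists>i j k. i < j \<and> j < k \<and> k < length (x # w) \<and> (x # w) ! k < (x # w) ! i \<and> (x # w) ! i < (x # w) ! j)
    \<longleftrightarrow> (\<exists>j k. j < k \<and> k < length w \<and> w ! k < x \<and> x < w ! j) \<or>
      (\<exists>i j k. i < j \<and> j < k \<and> k < length w \<and> w ! k < w ! i \<and> w ! i < w ! j)"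
    (is "(\<exists>i j k. ?P i j k) \<longleftrightarrow> ?A \<or> ?B")
  proof
    assume "\<exists>i j k. ?P i j k"
    then obtain i j k where P: "?P i j k" by blast
    then obtain j' k' where "j = Suc j'" "k = Suc k'" by (cases j; cases k) auto
    show "?A \<or> ?B"
    proof (cases i)
      case 0
      then have "j' < k' \<and> k' < length w \<and> w ! k' < x \<and> x < w ! j'"
        using P \<open>j = Suc j'\<close> \<open>k = Suc k'\<close> by simp
      then show ?thesis by blast
    next
      case (Suc i')
      then have "i' < j' \<and> j' < k' \<and> k' < length w \<and> w ! k' < w ! i' \<and> w ! i' < w ! j'"
        using P \<open>j = Suc j'\<close> \<open>k = Suc k'\<close> by simp
      then show ?thesis by blast
    qed
  next
    assume "?A \<or> ?B"
    then show "\<exists>i j k. ?P i j k"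
    proof
      assume ?A
      then obtain j k where "j < k \<and> k < length w \<and> w ! k < x \<and> x < w ! j" by blast
      then have "?P 0 (Suc j) (Suc k)" by simp
      then show ?thesis by blast
    next
      assume ?B
      then obtain i j k where "i < j \<and> j < k \<and> k < length w \<and> w ! k < w ! i \<and> w ! i < w ! j" by blast
      then have "?P (Suc i) (Suc j) (Suc k)" by simp
      then show ?thesis by blast
    qed
  qed
  moreover have "sorted_wrt (\<lambda>b d. \<not> (d < x \<and> x < b)) w \<longleftrightarrow>
      \<not> (\<exists>j k. j < k \<and> k < length w \<and> w ! k < x \<and> x < w ! j)"
    unfolding sorted_wrt_iff_nth_less by (meson order.strict_trans)
  ultimately show ?case using Cons.IH by (simp only: avoids_231.simps) blast
qed simp

lemma avoids_231_iff: "avoids w [2, 3, 1] \<longleftrightarrow> avoids_231 w"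
proof -
  have "w ! k < w ! i \<and> w ! i < w ! j \<longleftrightarrow>
      (w ! i < w ! j \<longleftrightarrow> (2::nat) < 3) \<and> (w ! j < w ! i \<longleftrightarrow> (3::nat) < 2) \<and>
      (w ! i < w ! k \<longleftrightarrow> (2::nat) < 1) \<and> (w ! k < w ! i \<longleftrightarrow> (1::nat) < 2) \<and>
      (w ! j < w ! k \<longleftrightarrow> (3::nat) < 1) \<and> (w ! k < w ! j \<longleftrightarrow> (1::nat) < 3)" for i j k
    by auto
  then show ?thesis
    unfolding avoids_def contains_pattern_triple avoids_231_iff_nth by simp
qed

lemma avoids_312_one_line:
  "avoids (one_line n \<pi>) [3, 1, 2] \<longleftrightarrow> avoids_312 ((\<lambda>x. (x, \<pi> x)) ` {1..n})"
proof -
  have nth: "one_line n \<pi> ! i = \<pi> (Suc i)" if "i < n" for i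
    using that by (simp add: one_line_def del: upt_Suc)
  have len: "length (one_line n \<pi>) = n" by (simp add: one_line_def)
  have "contains_pattern (one_line n \<pi>) [3, 1, 2] \<longleftrightarrow>
      (\<exists>i j k. i < j \<and> j < k \<and> k < n \<and> \<pi> (Suc j) < \<pi> (Suc k) \<and> \<pi> (Suc k) < \<pi> (Suc i))"
    unfolding contains_pattern_triple len
  proof (intro ex_cong1, rule conj_cong[OF refl], rule conj_cong[OF refl], rule conj_cong[OF refl])
    fix i j k assume *: "i < j" "j < k" "k < n"
    let ?w = "one_line n \<pi>"
    have "?w ! i = \<pi> (Suc i)" "?w ! j = \<pi> (Suc j)" "?w ! k = \<pi> (Suc k)"
      using * by (simp_all add: nth)
    then show "((?w ! i < ?w ! j \<longleftrightarrow> (3::nat) < 1) \<and> (?w ! j < ?w ! i \<longleftrightarrow> (1::nat) < 3) \<and>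
        (?w ! i < ?w ! k \<longleftrightarrow> (3::nat) < 2) \<and> (?w ! k < ?w ! i \<longleftrightarrow> (2::nat) < 3) \<and>
        (?w ! j < ?w ! k \<longleftrightarrow> (1::nat) < 2) \<and> (?w ! k < ?w ! j \<longleftrightarrow> (2::nat) < 1)) \<longleftrightarrow>
      \<pi> (Suc j) < \<pi> (Suc k) \<and> \<pi> (Suc k) < \<pi> (Suc i)"
      by auto
  qed
  also have "\<dots> \<longleftrightarrow> (\<exists>x\<in>{1..n}. \<exists>y\<in>{1..n}. \<exists>z\<in>{1..n}. x < y \<and> y < z \<and> \<pi> y < \<pi> z \<and> \<pi> z < \<pi> x)"
    (is "?A \<longleftrightarrow> ?B")
  proof
    assume ?A
    then obtain i j k where "i < j" "j < k" "k < n" "\<pi> (Suc j) < \<pi> (Suc k)" "\<pi> (Suc k) < \<pi> (Suc i)"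
      by blast
    then show ?B
      by (intro bexI[of _ "Suc i"] bexI[of _ "Suc j"] bexI[of _ "Suc k"]) auto
  next
    assume ?B
    then obtain x y z where *: "x \<in> {1..n}" "y \<in> {1..n}" "z \<in> {1..n}"
      "x < y" "y < z" "\<pi> y < \<pi> z" "\<pi> z < \<pi> x" by blast
    then show ?A
      by (intro exI[of _ "x - 1"] exI[of _ "y - 1"] exI[of _ "z - 1"]) auto
  qed
  also have "\<dots> \<longleftrightarrow> \<not> avoids_312 ((\<lambda>x. (x, \<pi> x)) ` {1..n})"
    unfolding avoids_312_def by blast
  finally show ?thesis by (simp add: avoids_def)
qed

text \<open>The closing edge has the least target, so in a 312 it can only be the 1, and any other
  value below the remaining targets serves equally well. This replaces the true closing value
  \<open>1\<close> by \<open>0\<close>.\<close>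

lemma avoids_312_steps_snoc_cong:
  assumes "\<And>y. y \<in> set (tl c) \<Longrightarrow> z < y" "\<And>y. y \<in> set (tl c) \<Longrightarrow> z' < y"
  shows "avoids_312 (steps (c @ [z])) \<longleftrightarrow> avoids_312 (steps (c @ [z']))"
proof -
  have "avoids_312 (steps (c @ [t]))"
    if s: "\<And>y. y \<in> set (tl c) \<Longrightarrow> s < y" and t: "\<And>y. y \<in> set (tl c) \<Longrightarrow> t < y"
      and av: "avoids_312 (steps (c @ [s]))" for s t
    unfolding avoids_312_def
  proof clarify
    fix x1 y1 x2 y2 x3 y3
    assume *: "(x1, y1) \<in> steps (c @ [t])" "(x2, y2) \<in> steps (c @ [t])" "(x3, y3) \<in> steps (c @ [t])"
      "x1 < x2" "x2 < x3" "y2 < y3" "y3 < y1"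
    have ge: "t \<le> y" if "(x, y) \<in> steps (c @ [t])" for x y
      using that t[of y] by (auto simp: in_steps_snoc less_imp_le dest: steps_memD(2))
    have inner: "(x, y) \<in> steps c" if "(x, y) \<in> steps (c @ [t])" "t < y" for x y
      using that by (auto simp: in_steps_snoc)
    have 3: "(x3, y3) \<in> steps c" using inner[OF *(3)] ge[OF *(2)] *(6) by simp
    have 1: "(x1, y1) \<in> steps c" using inner[OF *(1)] ge[OF *(3)] *(7) by simp
    obtain y2' where "(x2, y2') \<in> steps (c @ [s])" "y2' < y3"
      using *(2,6) s[OF steps_memD(2)[OF 3]] by (auto simp: in_steps_snoc)
    then show False
      using avoids_312D[OF av, of x1 y1 x2 y2' x3 y3] 1 3 *(4,5,7) by (simp add: in_steps_snoc)
  qed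
  from this[of z z'] this[of z' z] show ?thesis using assms by blast
qed

section \<open>Cyclic permutations and their cycle notations\<close>

lemma steps_map_upt: "steps (map f [0..<Suc n]) = (\<lambda>i. (f i, f (Suc i))) ` {..<n}"
proof (induction n)
  case (Suc n)
  have "steps (map f [0..<Suc (Suc n)]) = steps (map f [0..<n] @ [f n, f (Suc n)])" by simp
  also have "\<dots> = steps (map f [0..<Suc n]) \<union> {(f n, f (Suc n))}"
    by (subst steps_append) simp
  finally show ?case by (simp only: Suc.IH) (auto simp: lessThan_Suc)
qed simp

lemma cycle_notation_cyclic:
  assumes "cyclic_on \<pi> {1..n}"
  shows "distinct (cycle_notation n \<pi>)" "set (cycle_notation n \<pi>) = {1..n}"
    and "hd (cycle_notation n \<pi>) = 1"
    and "steps (cycle_notation n \<pi> @ [1]) = (\<lambda>x. (x, \<pi> x)) ` {1..n}"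
proof -
  have "{1..n} \<noteq> {}" using assms by (auto simp: cyclic_on_alldef)
  then have n: "1 \<le> n" by auto
  then have orb: "orbit \<pi> 1 = {1..n}" using assms by (intro orbit_cyclic_eq3) auto
  have self: "1 \<in> orbit \<pi> 1" unfolding orb using n by simp
  let ?d = "funpow_dist1 \<pi> 1 1"
  have orb': "orbit \<pi> 1 = (\<lambda>i. (\<pi> ^^ i) 1) ` {0..<?d}"
    by (rule orbit_conv_funpow_dist1[OF self])
  have inj: "inj_on (\<lambda>i. (\<pi> ^^ i) 1) {0..<?d}"
    by (rule inj_on_funpow_dist1[OF self])
  \<comment> \<open>The first return time of \<open>1\<close> equals the size of its orbit, hence
    \<open>n\<close>. So the first \<open>n\<close> iterates are distinct and the next one is
    \<open>1\<close> again.\<close>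
  have "card (orbit \<pi> 1) = ?d" unfolding orb' by (subst card_image[OF inj]) simp
  then have d: "?d = n" unfolding orb by simp
  show "distinct (cycle_notation n \<pi>)"
    using inj unfolding d by (simp add: cycle_notation_def distinct_map del: upt_Suc)
  show set: "set (cycle_notation n \<pi>) = {1..n}"
    using orb orb' unfolding d by (simp add: cycle_notation_def)
  show "hd (cycle_notation n \<pi>) = 1"
    using n by (simp add: cycle_notation_def hd_map)
  have "(\<pi> ^^ n) 1 = 1" using funpow_dist1_prop[OF self] unfolding d .
  then have "cycle_notation n \<pi> @ [1] = map (\<lambda>i. (\<pi> ^^ i) 1) [0..<Suc n]"
    by (simp add: cycle_notation_def)
  then have "steps (cycle_notation n \<pi> @ [1]) = (\<lambda>x. (x, \<pi> x)) ` set (cycle_notation n \<pi>)"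
    unfolding steps_map_upt by (auto simp: steps_map_upt cycle_notation_def image_image simp del: upt_Suc)
  then show "steps (cycle_notation n \<pi> @ [1]) = (\<lambda>x. (x, \<pi> x)) ` {1..n}"
    by (simp only: set)
qed

text \<open>The witness is \<open>cycle_of_list c\<close>: mapping its powers over \<open>c\<close>
  rotates \<open>c\<close>, so the iterates of \<open>1\<close> read off the entries of
  \<open>c\<close> in order.\<close>

lemma cycle_notation_surj:
  assumes "distinct c" "set c = {1..n}" "hd c = 1" "1 \<le> n"
  obtains \<pi> where "\<pi> permutes {1..n}" "cyclic_on \<pi> {1..n}" "cycle_notation n \<pi> = c"
proof -
  let ?\<pi> = "cycle_of_list c"
  have len: "length c = n" using distinct_card[OF assms(1)] assms(2) by simp
  have ne: "c \<noteq> []" using len assms(4) by auto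
  have pow: "(?\<pi> ^^ i) 1 = c ! (i mod n)" for i
  proof -
    have "(?\<pi> ^^ i) 1 = hd (map (?\<pi> ^^ i) c)" using ne assms(3) by (simp add: hd_map)
    also have "\<dots> = hd (rotate i c)" by (simp only: cyclic_rotation[OF assms(1)])
    also have "\<dots> = c ! (i mod n)" using hd_rotate_conv_nth[OF ne] len by simp
    finally show ?thesis .
  qed
  have "orbit ?\<pi> 1 = {1..n}"
  proof
    have "c ! (i mod n) \<in> {1..n}" for i
      using nth_mem[of "i mod n" c] assms(2,4) len by simp
    then show "orbit ?\<pi> 1 \<subseteq> {1..n}"
      unfolding orbit_altdef pow by blast
  next
    have "x \<in> orbit ?\<pi> 1" if "x \<in> set c" for x
    proof -
      obtain i where "i < n" "x = c ! i" using \<open>x \<in> set c\<close> len by (auto simp: in_set_conv_nth)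
      \<comment> \<open>Adding \<open>n\<close> makes the exponent positive, as \<open>orbit\<close>
        requires, even when \<open>i = 0\<close>.\<close>
      then have "x = (?\<pi> ^^ (i + n)) 1" unfolding pow by simp
      moreover have "0 < i + n" using assms(4) by simp
      ultimately show ?thesis unfolding orbit_altdef by blast
    qed
    then show "{1..n} \<subseteq> orbit ?\<pi> 1" using assms(2) by blast
  qed
  then have "cyclic_on ?\<pi> {1..n}" using assms(4) by (intro cyclic_on_singleI[of 1]) auto
  moreover have "?\<pi> permutes {1..n}" using cycle_permutes[of c] assms(2) by simp
  moreover have "cycle_notation n ?\<pi> = c"
    by (rule nth_equalityI) (simp_all add: cycle_notation_def pow len del: One_nat_def)
  ultimately show thesis using that by blast
qed

lemma bij_betw_cycle_notation:
  assumes "1 \<le> n"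
  shows "bij_betw (cycle_notation n) (cyclic_avoiders n [3, 1, 2] [2, 3, 1]) (cycle_words 1 n)"
proof -
  have iff: "\<pi> \<in> cyclic_avoiders n [3, 1, 2] [2, 3, 1] \<longleftrightarrow> cycle_notation n \<pi> \<in> cycle_words 1 n"
    if "\<pi> permutes {1..n}" "cyclic_on \<pi> {1..n}" for \<pi>
  proof -
    let ?c = "cycle_notation n \<pi>"
    note c = cycle_notation_cyclic[OF that(2)]
    have tl: "1 < y" if "y \<in> set (tl ?c)" for y
    proof -
      obtain c' where c': "?c = 1 # c'" using c(2,3) assms by (cases ?c) auto
      then have "y \<in> set ?c" "y \<noteq> 1" using c(1) that by auto
      then show ?thesis using c(2) by auto
    qed
    have "avoids (one_line n \<pi>) [3, 1, 2] \<longleftrightarrow> avoids_312 (steps (?c @ [1]))"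
      by (simp only: avoids_312_one_line c(4))
    also have "\<dots> \<longleftrightarrow> avoids_312 (steps (?c @ [0]))"
      by (rule avoids_312_steps_snoc_cong) (use tl in fastforce)+
    finally show ?thesis
      using that c(1-3)
      by (auto simp add: cyclic_avoiders_def cycle_words_def avoids_231_iff simp del: One_nat_def)
  qed
  show ?thesis
    unfolding bij_betw_def
  proof
    show "inj_on (cycle_notation n) (cyclic_avoiders n [3, 1, 2] [2, 3, 1])"
    proof (intro inj_onI ext)
      fix \<pi> \<rho> x
      assume \<pi>: "\<pi> \<in> cyclic_avoiders n [3, 1, 2] [2, 3, 1]"
        and \<rho>: "\<rho> \<in> cyclic_avoiders n [3, 1, 2] [2, 3, 1]"
        and eq: "cycle_notation n \<pi> = cycle_notation n \<rho>"
      \<comment> \<open>The closed list of edges is the graph on \<open>{1..n}\<close>; outside this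
        interval both permutations are the identity.\<close>
      have "(\<lambda>x. (x, \<pi> x)) ` {1..n} = (\<lambda>x. (x, \<rho> x)) ` {1..n}"
        using cycle_notation_cyclic(4)[of \<pi> n] cycle_notation_cyclic(4)[of \<rho> n] \<pi> \<rho> eq
        by (simp add: cyclic_avoiders_def)
      then have "x \<in> {1..n} \<Longrightarrow> \<pi> x = \<rho> x" by blast
      then show "\<pi> x = \<rho> x"
        using \<pi> \<rho> permutes_not_in[of \<pi> "{1..n}" x] permutes_not_in[of \<rho> "{1..n}" x]
        unfolding cyclic_avoiders_def by (cases "x \<in> {1..n}") simp_all
    qed
    show "cycle_notation n ` cyclic_avoiders n [3, 1, 2] [2, 3, 1] = cycle_words 1 n"
    proof (intro equalityI subsetI)
      fix c assume "c \<in> cycle_notation n ` cyclic_avoiders n [3, 1, 2] [2, 3, 1]"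
      then obtain \<pi> where "c = cycle_notation n \<pi>" "\<pi> \<in> cyclic_avoiders n [3, 1, 2] [2, 3, 1]" by blast
      then show "c \<in> cycle_words 1 n" using iff[of \<pi>] by (simp add: cyclic_avoiders_def)
    next
      fix c assume c: "c \<in> cycle_words 1 n"
      then have "distinct c" "set c = {1..n}" "hd c = 1" by (simp_all add: cycle_words_def)
      then obtain \<pi> where "\<pi> permutes {1..n}" "cyclic_on \<pi> {1..n}" "cycle_notation n \<pi> = c"
        using assms by (rule cycle_notation_surj)
      with c iff[of \<pi>] show "c \<in> cycle_notation n ` cyclic_avoiders n [3, 1, 2] [2, 3, 1]" by blast
    qed
  qed
qed

theorem theorem4p19:
  fixes n :: nat
  assumes "n \<ge> 1"
  shows "num_cyclic_avoiders n [3, 1, 2] [2, 3, 1] =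
    (\<Sum>k = 0..(n - 1) div 3. (n - 1 - k) choose (2 * k))"
proof -
  have "num_cyclic_avoiders n [3, 1, 2] [2, 3, 1] = card (cycle_words 1 n)"
    unfolding num_cyclic_avoiders_def
    by (rule bij_betw_same_card[OF bij_betw_cycle_notation[OF assms]])
  also have "\<dots> = diag_binomial_sum (n - 1)" using assms by (rule card_cycle_words)
  also have "\<dots> = (\<Sum>k = 0..(n - 1) div 3. (n - 1 - k) choose (2 * k))" by (rule diag_binomial_sum_eq)
  finally show ?thesis .
qed

end
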